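(* Let $Y_1,\ldots,Y_n$ be $n$ mutually commuting linear vector fields in $\mathbb{R}^n$ with $Y_1\wedge\cdots\wedge Y_n\neq0$, let $(\alpha^{jk})\in\mathfrak{gl}(n,\mathbb{R})$ be skew-symmetric, and put $X_j=\sum_k\alpha^{jk}Y_k$, $\delta_j=\operatorname{div}X_j$. For $r\in\mathbb{N}$, the joint spectrum $\sigma_r(\vec{X}_\delta^{\mathbb{C}})$ of the commuting operators $\vec{X}_\delta^{\mathbb{C}}=((X_1-\delta_1\operatorname{id})^{\mathbb{C}},\ldots,(X_n-\delta_n\operatorname{id})^{\mathbb{C}})$ on the finite-dimensional complex vector space $E_r^{\mathbb{C}}$ is given by $$\sigma_r(\vec{X}_\delta^{\mathbb{C}})=\{\alpha BI:\ I\in(\mathbb{N}\cup\{-1\})^n,\ |I|=r-n\}\subset\mathbb{C}^n,$$ where $|I|=\sum_jI_j$ and $B\in\mathfrak{gl}(n,\mathbb{C})$ is the matrix $B_{jk}=b_j^{kk}$ made up of the diagonals of the upper-triangular matrices $b_1,\ldots,b_n$ described in the context.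
   Context: $\mathbb{N}=\{0,1,2,\ldots\}$. Write $Y_k=\sum_{m,p}a_k^{mp}x_p\partial_{x_m}$ and $a_k=(a_k^{mp})_{m,p}\in\mathfrak{gl}(n,\mathbb{R})$; these matrices commute. Fix $U\in\mathrm{GL}(n,\mathbb{C})$ such that all $b_k=U^{-1}a_kU\in\mathfrak{gl}(n,\mathbb{C})$, with entries $b_k^{mp}$, are upper-triangular (such a $U$ exists). $\alpha=(\alpha^{jk})$ and $I$ is viewed as a column vector. $E_r=\mathcal{S}^r\mathbb{R}^{n*}$ is the space of homogeneous polynomials of degree $r$ on $\mathbb{R}^n$, on which vector fields act as derivations; $E_r^{\mathbb{C}}=\mathcal{S}^r\mathbb{C}^{n*}$ is its complexification, and the superscript $\mathbb{C}$ on operators denotes complexification. The joint spectrum of commuting operators $\vec{Z}=(Z_1,\ldots,Z_n)$ on a finite-dimensional complex vector space $E$ is the set of $\vec\lambda\in\mathbb{C}^n$ for which there exists a nonzero $v\in E$ with $Z_jv=\lambda_jv$ for all $j$. *)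

theory Defs
  imports "HOL-Analysis.Analysis"
begin

text \<open>
  A vector field on \<open>\<real>\<^sup>n\<close> is represented by its component function, so that
  \<open>X :: real^'n \<Rightarrow> real^'n\<close> stands for \<open>\<Sum>m. (X x $ m) \<partial>\<^bsub>x m\<^esub>\<close>. The coefficient matrix of a
  linear vector field \<open>Y\<close> is then the library's \<open>matrix Y\<close>, since \<open>Y x = matrix Y *v x\<close>.
\<close>

definition lie_derivative ::
  "(real^'n \<Rightarrow> real^'n) \<Rightarrow> (real^'n \<Rightarrow> real) \<Rightarrow> real^'n \<Rightarrow> real"
  where "lie_derivative X f = (\<lambda>x. frechet_derivative f (at x) (X x))"

definition lie_bracket ::
  "(real^'n \<Rightarrow> real^'n) \<Rightarrow> (real^'n \<Rightarrow> real^'n) \<Rightarrow> real^'n \<Rightarrow> real^'n"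
  where "lie_bracket X Y =
    (\<lambda>x. frechet_derivative Y (at x) (X x) - frechet_derivative X (at x) (Y x))"

definition divergence :: "(real^'n \<Rightarrow> real^'n) \<Rightarrow> real^'n \<Rightarrow> real"
  where "divergence X = (\<lambda>x. trace (matrix (frechet_derivative X (at x))))"

text \<open>
  The top-degree multivector field \<open>Y\<^sub>1 \<and> \<dots> \<and> Y\<^sub>n\<close>, as an alternating multilinear form on
  covectors: \<open>(v\<^sub>1 \<and> \<dots> \<and> v\<^sub>n)(\<xi>\<^sub>1, \<dots>, \<xi>\<^sub>n) = det (\<xi>\<^sub>i(v\<^sub>j))\<close>.
\<close>

definition wedge ::
  "('n \<Rightarrow> real^'n \<Rightarrow> real^'n) \<Rightarrow> real^'n \<Rightarrow> ('n::finite \<Rightarrow> ((real^'n) \<Rightarrow>\<^sub>L real)) \<Rightarrow> real"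
  where "wedge Y = (\<lambda>x \<xi>. det (\<chi> i j. blinfun_apply (\<xi> i) (Y j x)))"

definition multi_indices :: "nat \<Rightarrow> (nat^'n) set"
  where "multi_indices r = {I. (\<Sum>i\<in>UNIV. I $ i) = r}"

definition monomial_fun :: "nat^'n \<Rightarrow> real^'n \<Rightarrow> real"
  where "monomial_fun I = (\<lambda>x. \<Prod>i\<in>UNIV. (x $ i) ^ (I $ i))"

definition hom_polys :: "nat \<Rightarrow> (real^'n \<Rightarrow> real) set"
  where "hom_polys r = {f. \<exists>c. f = (\<lambda>x. \<Sum>I\<in>multi_indices r. c I * monomial_fun I x)}"

text \<open>
  For a real space \<open>V\<close> of real-valued functions, \<open>V \<otimes> \<complex>\<close> is realised as the complex-valued
  functions \<open>u + \<i> v\<close> with \<open>u, v \<in> V\<close>; an operator \<open>T\<close> on \<open>V\<close> extends by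
  \<open>u + \<i> v \<mapsto> T u + \<i> T v\<close>.
\<close>

definition complexify_space :: "('a \<Rightarrow> real) set \<Rightarrow> ('a \<Rightarrow> complex) set"
  where "complexify_space V = {f. (\<lambda>x. Re (f x)) \<in> V \<and> (\<lambda>x. Im (f x)) \<in> V}"

definition complexify_op ::
  "(('a \<Rightarrow> real) \<Rightarrow> ('a \<Rightarrow> real)) \<Rightarrow> ('a \<Rightarrow> complex) \<Rightarrow> ('a \<Rightarrow> complex)"
  where "complexify_op T f =
    (\<lambda>x. Complex (T (\<lambda>y. Re (f y)) x) (T (\<lambda>y. Im (f y)) x))"

lemma finite_multi_indices: "finite (multi_indices r :: (nat^'n) set)"
proof -
  have "multi_indices r \<subseteq> vec_lambda ` (PiE (UNIV :: 'n set) (\<lambda>_. {..r}))"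
  proof
    fix I :: "nat^'n" assume I: "I \<in> multi_indices r"
    have "I $ i \<le> r" for i
      using I member_le_sum[of i UNIV "\<lambda>i. I $ i"] by (auto simp: multi_indices_def)
    then have "vec_nth I \<in> PiE UNIV (\<lambda>_. {..r})" by (auto simp: PiE_def)
    then show "I \<in> vec_lambda ` (PiE (UNIV :: 'n set) (\<lambda>_. {..r}))"
      by (metis image_eqI vec_nth_inverse)
  qed
  then show ?thesis
    by (rule finite_subset) (intro finite_imageI finite_PiE, auto)
qed

text \<open>The complexification of \<open>hom_polys r\<close> is \<open>\<S>\<^sup>r \<complex>\<^sup>n\<^sup>*\<close>, its elements being restricted to \<open>\<real>\<^sup>n\<close>.\<close>

lemma complexify_hom_polys:
  "complexify_space (hom_polys r :: (real^'n \<Rightarrow> real) set) =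
   {f. \<exists>c. f = (\<lambda>x. \<Sum>I\<in>multi_indices r. c I * complex_of_real (monomial_fun I x))}"
  (is "?L = ?R")
proof
  show "?L \<subseteq> ?R"
  proof
    fix f :: "real^'n \<Rightarrow> complex" assume "f \<in> ?L"
    then obtain a b where
      a: "\<And>x. Re (f x) = (\<Sum>I\<in>multi_indices r. a I * monomial_fun I x)" and
      b: "\<And>x. Im (f x) = (\<Sum>I\<in>multi_indices r. b I * monomial_fun I x)"
      unfolding complexify_space_def hom_polys_def by (auto simp: fun_eq_iff)
    have "f = (\<lambda>x. \<Sum>I\<in>multi_indices r. Complex (a I) (b I) * complex_of_real (monomial_fun I x))"
      by (auto simp: fun_eq_iff complex_eq_iff a b)
    then show "f \<in> ?R"
      by (intro CollectI exI[where x = "\<lambda>I. Complex (a I) (b I)"])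
  qed
next
  show "?R \<subseteq> ?L"
  proof
    fix f :: "real^'n \<Rightarrow> complex" assume "f \<in> ?R"
    then obtain c where
      c: "f = (\<lambda>x. \<Sum>I\<in>multi_indices r. c I * complex_of_real (monomial_fun I x))" by blast
    have "(\<lambda>x. Re (f x)) = (\<lambda>x. \<Sum>I\<in>multi_indices r. Re (c I) * monomial_fun I x)"
         "(\<lambda>x. Im (f x)) = (\<lambda>x. \<Sum>I\<in>multi_indices r. Im (c I) * monomial_fun I x)"
      by (auto simp: c)
    then show "f \<in> ?L" unfolding complexify_space_def hom_polys_def
      by (intro CollectI conjI exI[where x = "\<lambda>I. Re (c I)"] exI[where x = "\<lambda>I. Im (c I)"])
  qed
qed

definition joint_spectrum ::
  "('a \<Rightarrow> complex) set \<Rightarrow> ('n \<Rightarrow> ('a \<Rightarrow> complex) \<Rightarrow> ('a \<Rightarrow> complex)) \<Rightarrow> (complex^'n) set"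
  where "joint_spectrum E Z =
    {l. \<exists>v\<in>E. v \<noteq> (\<lambda>_. 0) \<and> (\<forall>j. Z j v = (\<lambda>x. l $ j * v x))}"

text \<open>The linear order on the index type plays the role of the order on \<open>{1, \<dots>, n}\<close>.\<close>

definition upper_triangular :: "'a::zero^'n::{finite,linorder}^'n::{finite,linorder} \<Rightarrow> bool"
  where "upper_triangular A \<longleftrightarrow> (\<forall>i j. j < i \<longrightarrow> A $ i $ j = 0)"

end

theory Submission
  imports Defs "HOL-Library.Function_Algebras"
begin

text \<open>
  In the complex coordinates \<open>z = U\<inverse> x\<close> the field \<open>Y\<^sub>k\<close> has the upper triangular matrix \<open>b\<^sub>k\<close>, so
  \<open>X\<^sub>j - \<delta>\<^sub>j\<close> maps \<open>z\<^sup>J\<close> to \<open>(\<alpha> B (J - (1, \<dots>, 1)))\<^sub>j z\<^sup>J\<close> plus monomials obtained from \<open>z\<^sup>J\<close> by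
  replacing a factor \<open>z\<^sub>i\<close> by some \<open>z\<^sub>p\<close> with \<open>p > i\<close>. Hence every joint eigenvalue is one of these
  diagonal entries, with \<open>I = J - (1, \<dots>, 1)\<close>. Conversely, since the \<open>b\<^sub>k\<close> commute, for each \<open>i\<close> there
  is a linear form \<open>g\<^sub>i \<noteq> 0\<close> with \<open>Y\<^sub>k g\<^sub>i = b\<^sub>k\<^sup>i\<^sup>i g\<^sub>i\<close> for all \<open>k\<close>, and \<open>X\<^sub>j\<close> being a derivation,
  \<open>\<Prod>\<^sub>i g\<^sub>i ^ J\<^sub>i\<close> is a joint eigenvector for \<open>J\<close>.
\<close>

section \<open>Linear algebra: triangular families and their joint eigenvectors\<close>

text \<open>A nonzero complex coefficient vector has nonzero real or imaginary part, so its real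
  zero set lies in a hyperplane, and finitely many null sets do not cover R^k. This serves both to
  choose a generic combination of the \<open>b k\<close> and to show that a product of linear forms
  is nonzero on R^n.\<close>

lemma real_vector_off_hyperplanes:
  fixes P :: "(complex^'k::finite) set"
  assumes "finite P" "0 \<notin> P"
  obtains x :: "real^'k" where "\<And>m. m \<in> P \<Longrightarrow> (\<Sum>k\<in>UNIV. m $ k * of_real (x $ k)) \<noteq> 0"
proof -
  let ?H = "\<lambda>m :: complex^'k. {x :: real^'k. (\<Sum>k\<in>UNIV. m $ k * of_real (x $ k)) = 0}"
  have "negligible (?H m)" if "m \<in> P" for m
  proof -
    have "m \<noteq> 0" using that assms by auto
    then have "(\<chi> k. Re (m $ k)) \<noteq> 0 \<or> (\<chi> k. Im (m $ k)) \<noteq> 0"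
      by (auto simp: vec_eq_iff complex_eq_iff)
    moreover have "?H m \<subseteq> {x. (\<chi> k. Re (m $ k)) \<bullet> x = 0}" "?H m \<subseteq> {x. (\<chi> k. Im (m $ k)) \<bullet> x = 0}"
      by (auto simp: inner_vec_def complex_eq_iff)
    ultimately show ?thesis
      using negligible_hyperplane[of _ 0] negligible_subset by blast
  qed
  then have "negligible (\<Union> (?H ` P))"
    using assms by (intro negligible_Union) auto
  then have "\<Union> (?H ` P) \<noteq> UNIV"
    by (metis (no_types) non_negligible_UNIV)
  then show thesis using that by blast
qed

text \<open>Row vectors starting at position \<open>i\<close> or later are sent to ones starting
  strictly later, because the diagonal entry at \<open>i\<close> vanishes. The target has smaller
  dimension, so the map is not injective.\<close>

lemma upper_triangular_left_kernel:
  fixes N :: "complex^'n::{finite,linorder}^'n::{finite,linorder}"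
  assumes N: "upper_triangular N" "N $ i $ i = 0"
  obtains u where "u \<noteq> 0" "u v* N = 0"
proof (rule ccontr)
  assume "\<not> thesis"
  then have ker: "\<And>u. u v* N = 0 \<Longrightarrow> u = 0" using that by blast
  let ?f = "\<lambda>u. u v* N"
  let ?V = "{u :: complex^'n::{finite,linorder}. \<forall>p<i. u $ p = 0}" and ?W = "{u :: complex^'n::{finite,linorder}. \<forall>p\<le>i. u $ p = 0}"
  have lin: "linear ?f"
    by (rule linearI) (auto simp: vec_eq_iff vector_matrix_mult_def algebra_simps sum.distrib scaleR_sum_right)
  \<comment> \<open>Subspaces and dimensions are taken over the reals, which is enough for comparing
    dimensions under an injective map.\<close>
  have sub: "subspace ?V" "subspace ?W" by (auto simp: subspace_def)
  have "?f ` ?V \<subseteq> ?W"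
  proof clarify
    fix u :: "complex^'n::{finite,linorder}" and q assume u: "\<forall>p<i. u $ p = 0" and q: "q \<le> i"
    have "N $ p $ q * u $ p = 0" for p
      using N u q unfolding upper_triangular_def
      by (metis antisym_conv1 linorder_not_le mult_eq_0_iff order_le_less_trans)
    then have "(\<Sum>p\<in>UNIV. u $ p * N $ p $ q) = 0"
      by (intro sum.neutral) (simp add: mult.commute)
    then show "(u v* N) $ q = 0" by (simp add: vector_matrix_mult_def)
  qed
  then have "dim (?f ` ?V) \<le> dim ?W" by (rule dim_subset)
  moreover have "inj ?f"
    unfolding linear_injective_0[OF lin] using ker by blast
  then have "dim (?f ` ?V) = dim ?V"
    using dim_image_eq[OF lin inj_on_subset[OF _ subset_UNIV]] by blast
  ultimately have "dim ?V \<le> dim ?W" by simp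
  moreover have "?W \<subseteq> ?V" by (rule Collect_mono) (simp add: less_imp_le)
  ultimately have "?W = ?V"
    using subspace_dim_equal[OF sub(2) sub(1)] by simp
  moreover have "axis i 1 \<in> ?V" "axis i 1 \<notin> ?W" by (auto simp: axis_def)
  ultimately show False by blast
qed

text \<open>
  Take a real combination \<open>c\<close> of the \<open>b\<^sub>k\<close> so generic that two of its diagonal entries agree only if
  those of all \<open>b\<^sub>k\<close> do. The left eigenspace of \<open>c\<close> for its \<open>i\<close>-th diagonal entry is nonzero and
  invariant, and a vector in it whose first nonzero position \<open>p\<close> is as late as possible is a joint
  eigenvector, for the \<open>p\<close>-th diagonal entries. By the choice of \<open>c\<close> these are the \<open>i\<close>-th ones.
\<close>

lemma commuting_upper_triangular_left_eigenvector:
  fixes b :: "'k::finite \<Rightarrow> complex^'n::{finite,linorder}^'n::{finite,linorder}"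
  assumes tri: "\<And>k. upper_triangular (b k)"
    and comm: "\<And>k l. b k ** b l = b l ** b k"
  obtains u where "u \<noteq> 0" "\<And>k. u v* b k = b k $ i $ i *s u"
proof -
  obtain t :: "real^'k" where t: "\<And>m. m \<in> range (\<lambda>p. \<chi> k. b k $ p $ p - b k $ i $ i) - {0} \<Longrightarrow>
      (\<Sum>k\<in>UNIV. m $ k * of_real (t $ k)) \<noteq> 0"
    by (rule real_vector_off_hyperplanes[of "range (\<lambda>p. \<chi> k. b k $ p $ p - b k $ i $ i) - {0}"]) auto
  define c :: "complex^'n::{finite,linorder}^'n::{finite,linorder}" where "c = (\<chi> p q. \<Sum>k\<in>UNIV. of_real (t $ k) * b k $ p $ q)"
  have row_c: "u v* c = (\<Sum>k\<in>UNIV. of_real (t $ k) *s (u v* b k))" for u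
    by (simp add: vec_eq_iff c_def vector_matrix_mult_def sum_distrib_left sum_distrib_right mult_ac
        sum.swap[of _ "UNIV :: 'n set"])
  have row_linear: "(x + y) v* A = x v* A + y v* A" "(s *s x) v* A = s *s (x v* A)"
    for x y :: "complex^'n::{finite,linorder}" and s and A :: "complex^'n::{finite,linorder}^'n::{finite,linorder}"
    by (auto simp: vec_eq_iff vector_matrix_mult_def algebra_simps sum.distrib sum_distrib_left)
  have row_sum: "(\<Sum>k\<in>S. x k) v* A = (\<Sum>k\<in>S. x k v* A)" if "finite S"
    for S :: "'k set" and x :: "'k \<Rightarrow> complex^'n::{finite,linorder}" and A :: "complex^'n::{finite,linorder}^'n::{finite,linorder}"
    using that by (induction S) (auto simp: row_linear)
  define K where "K = {u. u v* c = c $ i $ i *s u}"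
  have K_add: "u + v \<in> K" if "u \<in> K" "v \<in> K" for u v
    using that by (auto simp: K_def row_linear vector_add_ldistrib)
  have K_scale: "s *s u \<in> K" if "u \<in> K" for s u
    using that by (auto simp: K_def row_linear vec_eq_iff)
  have K_inv: "u v* b k \<in> K" if "u \<in> K" for u k
  proof -
    \<comment> \<open>\<open>c\<close> is a combination of the \<open>b l\<close>, hence commutes
      with \<open>b k\<close>.\<close>
    have "(u v* b k) v* c = (u v* c) v* b k"
      by (simp only: row_c row_sum[OF finite] row_linear vector_matrix_mul_assoc comm[of k])
    then show ?thesis using that by (simp add: K_def row_linear)
  qed
  define Q where "Q = {p. \<exists>u\<in>K. u $ p \<noteq> 0 \<and> (\<forall>q<p. u $ q = 0)}"
  have lead: "\<exists>q\<in>Q. u $ q \<noteq> 0 \<and> (\<forall>p<q. u $ p = 0)" if "u \<in> K" "u \<noteq> 0" for u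
  proof -
    let ?q = "Min {q. u $ q \<noteq> 0}"
    have "?q \<in> {q. u $ q \<noteq> 0}" using that by (intro Min_in) (auto simp: vec_eq_iff)
    moreover have "\<forall>p<?q. u $ p = 0" by (metis (mono_tags) Min_le finite_code leD mem_Collect_eq)
    ultimately show ?thesis using that(1) unfolding Q_def by blast
  qed
  define p where "p = Max Q"
  obtain u0 where "u0 \<noteq> 0" and u0: "u0 v* (\<chi> q s. c $ q $ s - (if q = s then c $ i $ i else 0)) = 0"
  proof (rule upper_triangular_left_kernel)
    show "upper_triangular (\<chi> q s. c $ q $ s - (if q = s then c $ i $ i else 0))"
      using tri by (auto simp: upper_triangular_def c_def)
  qed auto
  have "(u0 v* c) $ s - c $ i $ i * u0 $ s = 0" for s
  proof -
    have "u0 $ q * (c $ q $ s - (if q = s then c $ i $ i else 0)) =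
        u0 $ q * c $ q $ s - (if q = s then c $ i $ i * u0 $ s else 0)" for q
      by (simp add: algebra_simps)
    then have "(\<Sum>q\<in>UNIV. u0 $ q * c $ q $ s - (if q = s then c $ i $ i * u0 $ s else 0)) = 0"
      using arg_cong[OF u0, of "\<lambda>v. v $ s"] by (simp add: vector_matrix_mult_def)
    then show ?thesis by (simp add: vector_matrix_mult_def sum_subtractf)
  qed
  then have "u0 \<in> K"
    by (simp add: K_def vec_eq_iff)
  with lead \<open>u0 \<noteq> 0\<close> have "Q \<noteq> {}" by blast
  then have "p \<in> Q" unfolding p_def by (intro Max_in) auto
  then obtain u where u: "u \<in> K" "u $ p \<noteq> 0" "\<forall>q<p. u $ q = 0" unfolding Q_def by blast
  have eig: "u v* b k = b k $ p $ p *s u" for k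
  proof -
    \<comment> \<open>Coordinate \<open>p\<close> cancels, and the earlier ones vanish by
      triangularity. A nonzero \<open>v\<close> would start after \<open>p\<close>, against the
      maximality of \<open>p\<close>.\<close>
    define v where "v = u v* b k + (- (b k $ p $ p)) *s u"
    have "v \<in> K" unfolding v_def by (intro K_add K_inv K_scale u)
    moreover have "v $ q = 0" if "q \<le> p" for q
    proof -
      define e where "e = u $ q * b k $ q $ q"
      have "u $ s * b k $ s $ q = (if s = q then e else 0)" for s
        using tri[of k] u(3) that unfolding upper_triangular_def e_def
        by (metis linorder_neqE mult_eq_0_iff order_less_le_trans)
      then have "(u v* b k) $ q = e"
        by (simp add: vector_matrix_mult_def)
      then show ?thesis using u(3) that by (cases "q = p") (auto simp: v_def e_def)
    qed
    moreover have "q \<le> p" if "q \<in> Q" for q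
      using that unfolding p_def by (intro Max_ge) auto
    ultimately have "v = 0"
      using lead[of v] by metis
    then show ?thesis by (simp add: v_def)
  qed
  have "(\<Sum>k\<in>UNIV. of_real (t $ k) * b k $ p $ p) * u $ p = c $ i $ i * u $ p"
    using u(1) unfolding K_def
    by (simp add: row_c eig vec_eq_iff sum_distrib_right mult.assoc)
  then have "(\<Sum>k\<in>UNIV. (b k $ p $ p - b k $ i $ i) * of_real (t $ k)) = 0"
    using u(2) by (simp add: c_def algebra_simps sum_subtractf)
  then have "(\<chi> k. b k $ p $ p - b k $ i $ i) = 0"
    using t[of "\<chi> k. b k $ p $ p - b k $ i $ i"] by fastforce
  then have "b k $ p $ p = b k $ i $ i" for k
    by (simp add: vec_eq_iff)
  then show thesis using that[of u] u(2) eig by (metis zero_index)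
qed


text \<open>
  The \<open>m J\<close> need not be independent: an eigenvector \<open>f\<close> in the span of the \<open>m K\<close>, \<open>K \<in> T\<close>, either has
  the eigenvalue of the \<open>J \<in> T\<close> of least weight or lies in the span with \<open>J\<close> removed. The operators
  are only required to be linear on the span, as Lie derivatives are junk off differentiable functions.
\<close>

lemma (in vector_space) triangular_joint_eigenvalue:
  fixes D :: "'j \<Rightarrow> 'b \<Rightarrow> 'b" and m :: "'i \<Rightarrow> 'b" and d :: "'i \<Rightarrow> 'j \<Rightarrow> 'a" and w :: "'i \<Rightarrow> nat"
  assumes fin: "finite S"
    and add: "\<And>j f g. f \<in> span (m ` S) \<Longrightarrow> g \<in> span (m ` S) \<Longrightarrow> D j (f + g) = D j f + D j g"
    and scale: "\<And>j a f. f \<in> span (m ` S) \<Longrightarrow> D j (a *s f) = a *s D j f"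
    and tri: "\<And>j J. J \<in> S \<Longrightarrow> D j (m J) - d J j *s m J \<in> span (m ` {K \<in> S. w J < w K})"
    and f: "f \<in> span (m ` S)" "f \<noteq> 0" "\<And>j. D j f = lam j *s f"
  obtains J where "J \<in> S" "lam = d J"
proof -
  have D0: "D j 0 = 0" for j using scale[of 0 j 0] span_zero by simp
  \<comment> \<open>\<open>T\<close> runs through the subsets of \<open>S\<close> closed under
    passing to larger weight; removing an element of least weight keeps this property.\<close>
  have main: "\<exists>J\<in>S. lam = d J"
    if "T \<subseteq> S" "\<And>J K. J \<in> T \<Longrightarrow> K \<in> S \<Longrightarrow> w J < w K \<Longrightarrow> K \<in> T" "f \<in> span (m ` T)" for T
    using that
  proof (induction "card T" arbitrary: T rule: less_induct)
    case (less T)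
    have finT: "finite T" using fin less.prems(1) finite_subset by blast
    have "T \<noteq> {}" using less.prems(3) f(2) by auto
    then obtain J where J: "J \<in> T" "\<And>K. K \<in> T \<Longrightarrow> w J \<le> w K"
      using arg_min_if_finite(1)[OF finT] arg_min_least[OF finT] that by blast
    let ?T = "T - {J}"
    have JS: "J \<in> S" using J less.prems by auto
    have up: "K \<in> ?T" if "L \<in> T" "K \<in> S" "w L < w K" for L K
      using that less.prems(2) J(2)[OF that(1)] by auto
    have spanS: "span (m ` ?T) \<subseteq> span (m ` S)"
      using less.prems(1) by (intro span_mono) auto
    have D_gen: "D j x \<in> span (m ` ?T)" if "x \<in> m ` ?T" for j x
    proof -
      obtain L where L: "L \<in> ?T" "x = m L" using \<open>x \<in> m ` ?T\<close> by blast
      then have "L \<in> S" using less.prems(1) by auto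
      have "D j x - d L j *s x \<in> span (m ` ?T)"
        using tri[OF \<open>L \<in> S\<close>] span_mono[of "m ` {K \<in> S. w L < w K}" "m ` ?T"] up[of L] L by blast
      then show ?thesis
        using span_add[OF _ span_scale[OF span_base[of x "m ` ?T"]], of "D j x - d L j *s x" "d L j"] L by simp
    qed
    \<comment> \<open>The induction carries membership of \<open>g\<close> itself, because
      \<open>D\<close> is known to be linear only on the span.\<close>
    have "g \<in> span (m ` ?T) \<and> D j g \<in> span (m ` ?T)" if "g \<in> span (m ` ?T)" for j g
      using that
    proof (induction rule: span_induct_alt)
      case base
      show ?case by (simp add: D0 span_zero)
    next
      case (step c x y)
      then have "x \<in> span (m ` S)" "y \<in> span (m ` S)"
        using spanS span_base[of x "m ` ?T"] by (simp_all add: subsetD)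
      then show ?case using step D_gen
        by (simp add: add scale span_scale span_add span_base)
    qed
    then have inv: "D j g \<in> span (m ` ?T)" if "g \<in> span (m ` ?T)" for j g using that by blast
    show ?case
    proof (cases "lam = d J")
      case False
      \<comment> \<open>Computing \<open>D j f\<close> in two ways puts \<open>k\<close> times
        \<open>lam j - d J j\<close> times \<open>m J\<close> into the span of the remaining
        generators; division by the nonzero difference then removes \<open>J\<close>.\<close>
      then obtain j where j: "lam j \<noteq> d J j" by auto
      have "insert (m J) (m ` ?T) = m ` T" using J(1) by auto
      then obtain k where k: "f - k *s m J \<in> span (m ` ?T)"
        using less.prems(3) span_breakdown_eq[of f "m J" "m ` ?T"] by auto
      define g where "g = f - k *s m J"
      have g: "g \<in> span (m ` ?T)" "f = g + k *s m J" using k by (auto simp: g_def)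
      have mJ: "m J \<in> span (m ` S)" using JS by (simp add: span_base)
      have "D j f = D j g + k *s D j (m J)"
        using g spanS mJ by (simp add: add scale span_scale subsetD)
      then have "k *s ((lam j - d J j) *s m J) = (D j g - lam j *s g) + k *s (D j (m J) - d J j *s m J)"
        using f(3)[of j] g(2) by (simp add: algebra_simps)
      moreover have "D j (m J) - d J j *s m J \<in> span (m ` ?T)"
        using tri[OF JS] span_mono[of "m ` {K \<in> S. w J < w K}" "m ` ?T"] up[of J] J(1) by blast
      ultimately have "k *s ((lam j - d J j) *s m J) \<in> span (m ` ?T)"
        using g(1) inv[OF g(1)] by (simp add: span_add span_diff span_scale)
      then have "inverse (lam j - d J j) *s (k *s ((lam j - d J j) *s m J)) \<in> span (m ` ?T)"
        by (rule span_scale)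
      moreover have "inverse (lam j - d J j) * (k * (lam j - d J j)) = k"
        using j by simp
      ultimately have "k *s m J \<in> span (m ` ?T)" using j by simp
      then have "f \<in> span (m ` ?T)" using g span_add by metis
      then show ?thesis
        using less.hyps[of ?T] less.prems(1) up finT J(1) by (meson Diff_subset DiffE card_Diff1_less order_trans)
    qed (use JS in auto)
  qed
  show thesis using main[of S] f(1) that by blast
qed


section \<open>Homogeneous forms in complex linear coordinates\<close>

lemma multi_indices_add_axis: "J + axis p 1 \<in> multi_indices (Suc r) \<longleftrightarrow> J \<in> multi_indices r"
  by (simp add: multi_indices_def sum.distrib axis_def)

lemma diff_axis_add_axis: "J $ i \<noteq> 0 \<Longrightarrow> J - axis i 1 + axis i 1 = (J :: nat^'n::finite)"
  by (auto simp: vec_eq_iff axis_def)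

text \<open>The eigenvalues are complex, so spans of functions are formed over the complex scalars
  acting pointwise.\<close>

interpretation cfun: vector_space "\<lambda>(c::complex) (f::'a \<Rightarrow> complex) x. c * f x"
  by unfold_locales (auto simp: fun_eq_iff algebra_simps)

text \<open>The factors are arbitrary functions, so that one notion covers the real coordinates, the
  triangularising coordinates and the eigenforms.\<close>

definition monomial_in :: "('n::finite \<Rightarrow> 'a \<Rightarrow> complex) \<Rightarrow> nat^'n \<Rightarrow> 'a \<Rightarrow> complex"
  where "monomial_in z J = (\<lambda>x. \<Prod>i\<in>UNIV. z i x ^ (J $ i))"

definition forms :: "('n::finite \<Rightarrow> 'a \<Rightarrow> complex) \<Rightarrow> nat \<Rightarrow> ('a \<Rightarrow> complex) set"
  where "forms z r = cfun.span (monomial_in z ` multi_indices r)"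

lemma monomial_in_add_axis: "monomial_in z (J + axis p 1) x = z p x * monomial_in z J x"
proof -
  have "z i x ^ (J + axis p 1) $ i = (if i = p then z p x else 1) * z i x ^ (J $ i)" for i
    by (simp add: axis_def)
  then show ?thesis by (simp add: monomial_in_def prod.distrib)
qed

text \<open>The factor \<open>J $ i\<close> stays on both sides because for \<open>J $ i = 0\<close>
  the truncated difference \<open>J - axis i 1\<close> is \<open>J\<close> itself.\<close>

lemma monomial_in_diff_axis: "of_nat (J $ i) * (z i x * monomial_in z (J - axis i 1) x) = of_nat (J $ i) * monomial_in z J x"
  using monomial_in_add_axis[of z "J - axis i 1" i x] diff_axis_add_axis[of J i] by (cases "J $ i = 0") auto

lemma sum_fun_apply: "(\<Sum>i\<in>A. f i) x = (\<Sum>i\<in>A. f i x)" for f :: "'i \<Rightarrow> 'a \<Rightarrow> 'b::comm_monoid_add"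
  by (induction A rule: infinite_finite_induct) auto

lemma complexify_hom_polys_eq_forms:
  "complexify_space (hom_polys r) = forms (\<lambda>i (x :: real^'n::finite). of_real (x $ i)) r"
proof -
  have mono: "complex_of_real (monomial_fun I x) = monomial_in (\<lambda>i x. of_real (x $ i)) I x"
    for I and x :: "real^'n"
    by (simp add: monomial_fun_def monomial_in_def)
  let ?m = "monomial_in (\<lambda>i (x :: real^'n). complex_of_real (x $ i))"
  let ?R = "{f. \<exists>c. f = (\<lambda>x. \<Sum>I\<in>multi_indices r. c I * ?m I x)}"
  have "?R \<subseteq> forms (\<lambda>i x. of_real (x $ i)) r"
  proof clarify
    fix c
    have "(\<lambda>x. \<Sum>I\<in>multi_indices r. c I * ?m I x) = (\<Sum>I\<in>multi_indices r. (\<lambda>x. c I * ?m I x))"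
      by (simp add: fun_eq_iff sum_fun_apply)
    then show "(\<lambda>x. \<Sum>I\<in>multi_indices r. c I * ?m I x) \<in> forms (\<lambda>i x. of_real (x $ i)) r"
      unfolding forms_def by (simp only:) (intro cfun.span_sum cfun.span_scale cfun.span_base imageI)
  qed
  moreover have "forms (\<lambda>i x. of_real (x $ i)) r \<subseteq> ?R"
    unfolding forms_def
  proof (rule cfun.span_minimal)
    show "?m ` multi_indices r \<subseteq> ?R"
    proof clarify
      fix J :: "nat^'n" assume "J \<in> multi_indices r"
      then have "?m J = (\<lambda>x. \<Sum>I\<in>multi_indices r. (if I = J then 1 else 0) * ?m I x)"
        by (simp add: fun_eq_iff if_distrib[of "\<lambda>a. a * _"] finite_multi_indices cong: if_cong)
      then show "\<exists>c. ?m J = (\<lambda>x. \<Sum>I\<in>multi_indices r. c I * ?m I x)"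
        by (rule exI[of _ "\<lambda>I. if I = J then 1 else 0"])
    qed
    show "cfun.subspace ?R"
    proof (rule cfun.subspaceI)
      show "0 \<in> ?R" by (auto simp: fun_eq_iff intro!: exI[of _ "\<lambda>_. 0"])
      fix f g and a :: complex
      assume "f \<in> ?R"
      then obtain c where c: "f = (\<lambda>x. \<Sum>I\<in>multi_indices r. c I * ?m I x)" by blast
      then show "(\<lambda>x. a * f x) \<in> ?R"
        by (auto simp: fun_eq_iff sum_distrib_left mult.assoc intro!: exI[of _ "\<lambda>I. a * c I"])
      assume "g \<in> ?R"
      then obtain d where d: "g = (\<lambda>x. \<Sum>I\<in>multi_indices r. d I * ?m I x)" by blast
      show "f + g \<in> ?R"
        by (auto simp: c d fun_eq_iff sum.distrib distrib_right intro!: exI[of _ "\<lambda>I. c I + d I"])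
    qed
  qed
  ultimately show ?thesis by (auto simp: complexify_hom_polys mono)
qed

text \<open>Bilinearity reduces this to a coordinate times a monomial: the first induction runs over
  \<open>f\<close>, the second over \<open>l\<close>.\<close>

lemma linear_form_times_form:
  assumes "l \<in> cfun.span (range z)" "f \<in> forms z r"
  shows "(\<lambda>x. l x * f x) \<in> forms z (Suc r)"
proof -
  have coord: "(\<lambda>x. z p x * f x) \<in> forms z (Suc r)" for p
    using assms(2) unfolding forms_def
  proof (induction rule: cfun.span_induct_alt)
    case base
    show ?case using cfun.span_zero by (simp add: zero_fun_def)
  next
    case (step c m g)
    then obtain J where J: "J \<in> multi_indices r" "m = monomial_in z J" by blast
    have "(\<lambda>x. z p x * m x) \<in> cfun.span (monomial_in z ` multi_indices (Suc r))"
      unfolding J(2) monomial_in_add_axis[symmetric]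
      by (intro cfun.span_base imageI) (simp only: multi_indices_add_axis J(1))
    from cfun.span_add[OF cfun.span_scale[OF this, of c] step.IH]
    show ?case by (simp add: plus_fun_def algebra_simps)
  qed
  show ?thesis
    using assms(1)
  proof (induction rule: cfun.span_induct_alt)
    case base
    show ?case using cfun.span_zero by (simp add: zero_fun_def forms_def)
  next
    case (step c m g)
    then have "(\<lambda>x. m x * f x) \<in> forms z (Suc r)" using coord by auto
    from cfun.span_add[OF cfun.span_scale[OF this[unfolded forms_def], of c] step.IH[unfolded forms_def]]
    show ?case by (simp add: plus_fun_def algebra_simps forms_def)
  qed
qed

text \<open>Induction on the degree, splitting off one linear factor at a time.\<close>

lemma monomial_in_linear_forms:
  fixes g z :: "'n::finite \<Rightarrow> 'a \<Rightarrow> complex"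
  assumes "\<And>i. g i \<in> cfun.span (range z)" "J \<in> multi_indices r"
  shows "monomial_in g J \<in> forms z r"
  using assms(2)
proof (induction r arbitrary: J)
  case 0
  then have "J = 0" by (simp add: multi_indices_def vec_eq_iff)
  then have "monomial_in g J = monomial_in z J" by (simp add: monomial_in_def)
  then show ?case using 0 by (auto simp: forms_def intro: cfun.span_base)
next
  case (Suc r)
  then obtain i where "J $ i \<noteq> 0" by (fastforce simp: multi_indices_def)
  then have J: "J = (J - axis i 1) + axis i 1" by (rule diff_axis_add_axis[symmetric])
  then have "J - axis i 1 \<in> multi_indices r" using Suc.prems multi_indices_add_axis by metis
  then have "(\<lambda>x. g i x * monomial_in g (J - axis i 1) x) \<in> forms z (Suc r)"
    by (intro linear_form_times_form assms Suc.IH)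
  moreover have "monomial_in g J = (\<lambda>x. g i x * monomial_in g (J - axis i 1) x)"
    by (subst J) (simp only: monomial_in_add_axis[abs_def])
  ultimately show ?case by simp
qed

text \<open>Used in both directions, this makes the space of forms independent of the linear
  coordinates.\<close>

lemma forms_mono:
  fixes g z :: "'n::finite \<Rightarrow> 'a \<Rightarrow> complex"
  assumes "\<And>i. g i \<in> cfun.span (range z)"
  shows "forms g r \<subseteq> forms z r"
  using monomial_in_linear_forms[of g z, OF assms] unfolding forms_def
  by (intro cfun.span_minimal cfun.subspace_span) blast

section \<open>Action of the twisted Lie derivatives on monomials\<close>

text \<open>The product rule; where \<open>J $ i = 0\<close> the truncated exponent is harmless, as
  the term carries the factor \<open>J $ i\<close>.\<close>

lemma monomial_in_has_derivative:
  assumes "\<And>i. bounded_linear (z i)"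
  shows "(monomial_in z J has_derivative
      (\<lambda>h. \<Sum>i\<in>UNIV. of_nat (J $ i) * (z i h * monomial_in z (J - axis i 1) x))) (at x)"
proof -
  have "z i x ^ (J $ i - 1) * (\<Prod>k\<in>UNIV - {i}. z k x ^ (J $ k)) = monomial_in z (J - axis i 1) x" for i
    unfolding monomial_in_def prod.remove[OF finite UNIV_I, of _ i]
    by (auto simp: axis_def intro!: arg_cong2[where f = "(*)"] prod.cong)
  moreover have "(monomial_in z J has_derivative (\<lambda>h. \<Sum>i\<in>UNIV.
      (of_nat (J $ i) * z i h * z i x ^ (J $ i - 1)) * (\<Prod>k\<in>UNIV - {i}. z k x ^ (J $ k)))) (at x)"
    unfolding monomial_in_def
    by (intro has_derivative_prod has_derivative_power bounded_linear_imp_has_derivative assms)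
  ultimately show ?thesis by (simp add: mult.assoc)
qed

lemma forms_differentiable:
  assumes "\<And>i. bounded_linear (z i)" "f \<in> forms z r"
  shows "f differentiable (at x)"
  using assms(2) unfolding forms_def
proof (induction rule: cfun.span_induct_alt)
  case base
  show ?case by (simp add: zero_fun_def)
next
  case (step c m g)
  then have "m differentiable (at x)"
    using monomial_in_has_derivative[of z, OF assms(1)] differentiable_def by blast
  then show ?case using step.IH by (simp add: plus_fun_def)
qed

text \<open>A name for the operator of the theorem. Its value is meaningful only for differentiable
  arguments, whence the hypotheses below.\<close>

definition twisted_lie :: "(real^'n \<Rightarrow> real^'n::finite) \<Rightarrow> (real^'n \<Rightarrow> complex) \<Rightarrow> real^'n \<Rightarrow> complex"
  where "twisted_lie X = complexify_op (\<lambda>f x. lie_derivative X f x - divergence X x * f x)"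

text \<open>Real and imaginary parts commute with differentiation, so complex-valued functions can
  be differentiated directly; the divergence of a linear field is the constant trace of its
  matrix.\<close>

lemma twisted_lie_eq:
  assumes "linear X" "\<And>x. (f has_derivative f' x) (at x)"
  shows "twisted_lie X f = (\<lambda>x. f' x (X x) - of_real (trace (matrix X)) * f x)"
proof
  fix x
  have "frechet_derivative X (at x) = X"
    using assms(1) by (metis frechet_derivative_at linear_imp_has_derivative)
  moreover have "frechet_derivative (\<lambda>y. Re (f y)) (at x) = (\<lambda>h. Re (f' x h))"
      "frechet_derivative (\<lambda>y. Im (f y)) (at x) = (\<lambda>h. Im (f' x h))"
    using assms(2)[of x] by (auto intro!: frechet_derivative_at[symmetric] derivative_intros)
  ultimately show "twisted_lie X f x = f' x (X x) - of_real (trace (matrix X)) * f x"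
    by (simp add: twisted_lie_def complexify_op_def lie_derivative_def divergence_def complex_eq_iff)
qed

lemma twisted_lie_add:
  assumes "linear X" "\<And>x. f differentiable (at x)" "\<And>x. g differentiable (at x)"
  shows "twisted_lie X (f + g) = twisted_lie X f + twisted_lie X g"
proof -
  have f: "(f has_derivative frechet_derivative f (at x)) (at x)"
    and g: "(g has_derivative frechet_derivative g (at x)) (at x)" for x
    using assms frechet_derivative_works by blast+
  then have "(f + g has_derivative (\<lambda>h. frechet_derivative f (at x) h + frechet_derivative g (at x) h)) (at x)" for x
    unfolding plus_fun_def by (intro has_derivative_add)
  note twisted_lie_eq[OF assms(1) this] twisted_lie_eq[OF assms(1) f] twisted_lie_eq[OF assms(1) g]
  then show ?thesis by (simp add: fun_eq_iff ring_distribs)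
qed

lemma twisted_lie_scale:
  assumes "linear X" "\<And>x. f differentiable (at x)"
  shows "twisted_lie X (\<lambda>x. c * f x) = (\<lambda>x. c * twisted_lie X f x)"
proof -
  have f: "(f has_derivative frechet_derivative f (at x)) (at x)" for x
    using assms frechet_derivative_works by blast
  then have "((\<lambda>x. c * f x) has_derivative (\<lambda>h. c * frechet_derivative f (at x) h)) (at x)" for x
    by (intro has_derivative_mult_right)
  note twisted_lie_eq[OF assms(1) this] twisted_lie_eq[OF assms(1) f]
  then show ?thesis by (simp only: right_diff_distrib mult.left_commute)
qed

lemma twisted_lie_monomial_in:
  assumes "linear X" "\<And>i. bounded_linear (z i)"
  shows "twisted_lie X (monomial_in z J) = (\<lambda>x. (\<Sum>i\<in>UNIV. of_nat (J $ i) * (z i (X x) * monomial_in z (J - axis i 1) x))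
     - of_real (trace (matrix X)) * monomial_in z J x)"
  by (rule twisted_lie_eq[OF assms(1) monomial_in_has_derivative[of z, OF assms(2)]])


section \<open>Joint eigenvalues and joint eigenforms\<close>

text \<open>In triangularising coordinates the operators are triangular on monomials, so a joint
  eigenvalue is a diagonal entry. Subtracting the trace turns \<open>J $ i\<close> into
  \<open>J $ i - 1\<close>.\<close>

lemma twisted_lie_joint_eigenvalue:
  fixes z :: "'n::{finite,linorder} \<Rightarrow> real^'n::{finite,linorder} \<Rightarrow> complex"
    and X :: "'j \<Rightarrow> real^'n::{finite,linorder} \<Rightarrow> real^'n::{finite,linorder}"
  assumes linear: "\<And>j. linear (X j)" and bl: "\<And>i. bounded_linear (z i)"
    and z: "\<And>i j x. z i (X j x) = (\<Sum>p\<in>UNIV. c j i p * z p x)"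
    and c: "\<And>i j p. p < i \<Longrightarrow> c j i p = 0"
    and tr: "\<And>j. of_real (trace (matrix (X j))) = (\<Sum>i\<in>UNIV. c j i i)"
    and f: "f \<in> forms z r" "f \<noteq> 0" "\<And>j. twisted_lie (X j) f = (\<lambda>x. l j * f x)"
  shows "\<exists>J\<in>multi_indices r. l = (\<lambda>j. \<Sum>i\<in>UNIV. c j i i * (of_nat (J $ i) - 1))"
proof -
  define d :: "nat^'n::{finite,linorder} \<Rightarrow> 'j \<Rightarrow> complex" where
    "d = (\<lambda>J j. \<Sum>i\<in>UNIV. c j i i * (of_nat (J $ i) - 1))"
  \<comment> \<open>The weight of a monomial sums the positions of its factors, so replacing a
    factor by one of larger index raises it.\<close>
  define pos :: "'n \<Rightarrow> nat" where "pos = (\<lambda>i. card {..<i})"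
  have pos: "pos i < pos p" if "i < p" for i p
    unfolding pos_def using that by (intro psubset_card_mono) (auto intro: less_trans)
  define w :: "nat^'n::{finite,linorder} \<Rightarrow> nat" where "w = (\<lambda>J. \<Sum>i\<in>UNIV. J $ i * pos i)"
  have w_axis: "w (J + axis p 1) = w J + pos p" for J p
  proof -
    have "(J + axis p 1) $ i * pos i = J $ i * pos i + (if i = p then pos p else 0)" for i
      by (simp add: axis_def)
    then show ?thesis by (simp add: w_def sum.distrib)
  qed
  have tri: "twisted_lie (X j) (monomial_in z J) - (\<lambda>x. d J j * monomial_in z J x)
      \<in> cfun.span (monomial_in z ` {K \<in> multi_indices r. w J < w K})"
    if J: "J \<in> multi_indices r" for j J
  proof -
    \<comment> \<open>The guard \<open>J $ i \<noteq> 0\<close> matters: with truncated subtraction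
      \<open>?K i p\<close> would otherwise have the wrong degree.\<close>
    let ?e = "\<lambda>i p. if J $ i \<noteq> 0 \<and> i < p then of_nat (J $ i) * c j i p else 0"
    let ?K = "\<lambda>i p. J - axis i 1 + axis p 1"
    have "of_nat (J $ i) * (z i (X j x) * monomial_in z (J - axis i 1) x)
        = of_nat (J $ i) * c j i i * monomial_in z J x + (\<Sum>p\<in>UNIV. ?e i p * monomial_in z (?K i p) x)" for i x
    proof -
      have "of_nat (J $ i) * (c j i p * z p x * monomial_in z (J - axis i 1) x)
        = (if p = i then of_nat (J $ i) * c j i i * monomial_in z J x else 0) + ?e i p * monomial_in z (?K i p) x" for p
        using monomial_in_diff_axis[of J i z x] c[of p i j] unfolding monomial_in_add_axis
        by (cases p i rule: linorder_cases) (auto simp: algebra_simps)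
      then show ?thesis
        by (simp add: z sum_distrib_left sum_distrib_right sum.distrib)
    qed
    then have "twisted_lie (X j) (monomial_in z J) - (\<lambda>x. d J j * monomial_in z J x)
       = (\<Sum>i\<in>UNIV. \<Sum>p\<in>UNIV. (\<lambda>x. ?e i p * monomial_in z (?K i p) x))"
      by (simp add: twisted_lie_monomial_in[OF linear bl] fun_eq_iff sum_fun_apply tr d_def
          sum.distrib sum_distrib_left sum_distrib_right sum_subtractf algebra_simps)
    moreover have "(\<lambda>x. ?e i p * monomial_in z (?K i p) x)
        \<in> cfun.span (monomial_in z ` {K \<in> multi_indices r. w J < w K})" for i p
    proof (cases "J $ i \<noteq> 0 \<and> i < p")
      case True
      then have J': "J = J - axis i 1 + axis i 1" using diff_axis_add_axis[of J i] by metis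
      have "?K i p \<in> multi_indices r"
      \<comment> \<open>\<open>multi_indices_add_axis\<close> needs a successor degree; degree 0 is
        excluded by \<open>J $ i \<noteq> 0\<close>.\<close>
      proof (cases r)
        case 0
        then show ?thesis using J True by (simp add: multi_indices_def)
      next
        case (Suc r')
        then show ?thesis using J J' multi_indices_add_axis by metis
      qed
      moreover have "w J < w (?K i p)"
        using w_axis[of "J - axis i 1"] pos[of i p] True J' by (metis add_less_cancel_left)
      ultimately show ?thesis
        by (intro cfun.span_scale cfun.span_base imageI) simp
    next
      case False
      then have "(\<lambda>x. ?e i p * monomial_in z (?K i p) x) = 0" by auto
      then show ?thesis by (simp only: cfun.span_zero)
    qed
    ultimately show ?thesis by (simp only:) (intro cfun.span_sum)
  qed
  have diff: "h differentiable (at x)" if "h \<in> cfun.span (monomial_in z ` multi_indices r)" for h x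
    using forms_differentiable[of z, OF bl] that unfolding forms_def by blast
  obtain J where "J \<in> multi_indices r" "l = d J"
  proof (rule cfun.triangular_joint_eigenvalue[where D = "\<lambda>j. twisted_lie (X j)"])
    show "f \<in> cfun.span (monomial_in z ` multi_indices r)" using f(1) by (simp add: forms_def)
  qed (auto simp: finite_multi_indices f diff twisted_lie_add[OF linear] twisted_lie_scale[OF linear] intro: tri)
  then show ?thesis by (auto simp: d_def)
qed

text \<open>A derivation adds up the eigenvalues of the factors, and the trace removes each
  \<open>\<mu> i\<close> once.\<close>

lemma twisted_lie_monomial_in_eigenforms:
  assumes "linear X" "\<And>i. bounded_linear (g i)" "\<And>i x. g i (X x) = \<mu> i * g i x"
    and "of_real (trace (matrix X)) = (\<Sum>i\<in>UNIV. \<mu> i)"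
  shows "twisted_lie X (monomial_in g J) = (\<lambda>x. (\<Sum>i\<in>UNIV. \<mu> i * (of_nat (J $ i) - 1)) * monomial_in g J x)"
proof -
  have "of_nat (J $ i) * (g i (X x) * monomial_in g (J - axis i 1) x) = \<mu> i * of_nat (J $ i) * monomial_in g J x" for i x
    using monomial_in_diff_axis[of J i g x] by (simp add: assms(3) mult_ac)
  then show ?thesis
    by (simp only: twisted_lie_monomial_in[OF assms(1,2)] fun_eq_iff assms(4))
      (simp add: sum_distrib_left sum_distrib_right sum_subtractf right_diff_distrib left_diff_distrib mult_ac)
qed

section \<open>Shift of the multi-indices and the joint spectrum\<close>

text \<open>The substitution I = J - (1, ..., 1): entries at least -1 become natural numbers, and
  the sum changes by n.\<close>

lemma shifted_multi_indices:
  "{F I | I :: int^'n::finite. (\<forall>i. I $ i \<in> \<nat> \<union> {-1}) \<and> (\<Sum>i\<in>UNIV. I $ i) = int r - int CARD('n)} =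
   (\<lambda>J. F (\<chi> i. int (J $ i) - 1)) ` multi_indices r" (is "?L = ?R")
proof (intro equalityI subsetI)
  fix l assume "l \<in> ?L"
  then obtain I :: "int^'n" where
    I: "\<And>i. I $ i \<in> \<nat> \<union> {-1}" "(\<Sum>i\<in>UNIV. I $ i) = int r - int CARD('n)" "l = F I" by blast
  define J where "J = (\<chi> i. nat (I $ i + 1))"
  have IJ: "I $ i = int (J $ i) - 1" for i
    using I(1)[of i] by (auto simp: J_def Nats_def)
  then have "int (\<Sum>i\<in>UNIV. J $ i) = int r"
    using I(2) by (simp add: sum_subtractf)
  then have "J \<in> multi_indices r"
    unfolding multi_indices_def of_nat_eq_iff by simp
  moreover have "I = (\<chi> i. int (J $ i) - 1)" using IJ by (simp add: vec_eq_iff)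
  ultimately show "l \<in> ?R" using I(3) by blast
next
  fix l assume "l \<in> ?R"
  then obtain J where J: "J \<in> multi_indices r" "l = F (\<chi> i. int (J $ i) - 1)" by blast
  have "int (J $ i) - 1 \<in> \<nat> \<union> {-1}" for i
  proof (cases "J $ i = 0")
    case False
    then have "int (J $ i) - 1 = int (J $ i - 1)" by simp
    then show ?thesis by (metis UnI1 of_nat_in_Nats)
  qed simp
  moreover have "(\<Sum>i\<in>UNIV. int (J $ i) - 1) = int r - int CARD('n)"
    using J(1) by (auto simp: sum_subtractf multi_indices_def)
  ultimately show "l \<in> ?L"
    using J(2) by (intro CollectI exI[of _ "\<chi> i. int (J $ i) - 1"]) simp
qed

theorem theorem7:
  fixes Y X :: "'n::{finite,linorder} \<Rightarrow> real^'n::{finite,linorder} \<Rightarrow> real^'n::{finite,linorder}"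
    and \<alpha> :: "real^'n::{finite,linorder}^'n::{finite,linorder}"
    and U B :: "complex^'n::{finite,linorder}^'n::{finite,linorder}"
    and b :: "'n::{finite,linorder} \<Rightarrow> complex^'n::{finite,linorder}^'n::{finite,linorder}"
    and r :: nat
  assumes "\<And>k. linear (Y k)"
    and "\<And>j k. lie_bracket (Y j) (Y k) = (\<lambda>x. 0)"
    and "wedge Y \<noteq> (\<lambda>x \<xi>. 0)"
    and "transpose \<alpha> = - \<alpha>"
    and "\<And>j. X j = (\<lambda>x. \<Sum>k\<in>UNIV. \<alpha> $ j $ k *\<^sub>R Y k x)"
    and "invertible U"
    and "\<And>k. b k = matrix_inv U ** map_matrix complex_of_real (matrix (Y k)) ** U"
    and "\<And>k. upper_triangular (b k)"
    and "B = (\<chi> j k. b j $ k $ k)"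
  shows "joint_spectrum (complexify_space (hom_polys r))
           (\<lambda>j. complexify_op (\<lambda>f x. lie_derivative (X j) f x - divergence (X j) x * f x)) =
         {map_matrix complex_of_real \<alpha> *v (B *v (\<chi> i. of_int (I $ i))) | I :: int^'n::{finite,linorder}.
            (\<forall>i. I $ i \<in> \<nat> \<union> {-1}) \<and> (\<Sum>i\<in>UNIV. I $ i) = int r - int CARD('n::{finite,linorder})}"
proof -
  define x\<^sub>c :: "real^'n::{finite,linorder} \<Rightarrow> complex^'n::{finite,linorder}" where "x\<^sub>c = (\<lambda>x. \<chi> i. of_real (x $ i))"
  \<comment> \<open>The coordinates U^-1 x, in which Y_k has matrix \<open>b k\<close> and X_j has
    matrix \<open>c j\<close>.\<close>
  define z where "z = (\<lambda>i x. (matrix_inv U *v x\<^sub>c x) $ i)"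
  define c where "c = (\<lambda>j p q. \<Sum>k\<in>UNIV. of_real (\<alpha> $ j $ k) * b k $ p $ q)"
  have U: "matrix_inv U ** U = mat 1" "U ** matrix_inv U = mat 1"
    using someI_ex[OF assms(6)[unfolded invertible_def]] by (auto simp: matrix_inv_def)
  have U_assoc: "U ** (matrix_inv U ** A) = A" for A :: "complex^'n::{finite,linorder}^'n::{finite,linorder}"
    by (simp add: matrix_mul_assoc U)
  have Y_matrix: "matrix (Y k) *v x = Y k x" for k x
    using assms(1)[of k] by (simp add: matrix_works linear_matrix_vector_mul_eq)
  \<comment> \<open>A linear map is its own derivative, so the bracket of linear fields is, up to
    sign, the commutator of the maps.\<close>
  have "frechet_derivative (Y k) (at x) = Y k" for k x
    using assms(1) by (metis frechet_derivative_at linear_imp_has_derivative)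
  then have "Y j (Y k x) = Y k (Y j x)" for j k x
    using fun_cong[OF assms(2)[of k j], of x] by (simp add: lie_bracket_def)
  then have Y_comm: "matrix (Y j) ** matrix (Y k) = matrix (Y k) ** matrix (Y j)" for j k
    by (simp add: matrix_eq matrix_vector_mul_assoc[symmetric] Y_matrix)
  have map_mult: "map_matrix complex_of_real (M ** N) = map_matrix complex_of_real M ** map_matrix complex_of_real N"
    for M N :: "real^'n::{finite,linorder}^'n::{finite,linorder}"
    by (simp add: vec_eq_iff map_matrix_def matrix_matrix_mult_def)
  have "b j ** b k = matrix_inv U ** (map_matrix complex_of_real (matrix (Y j) ** matrix (Y k)) ** U)" for j k
    by (simp add: assms(7) matrix_mul_assoc[symmetric] U_assoc map_mult)
  then have b_comm: "b j ** b k = b k ** b j" for j k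
    by (simp only: Y_comm[of j k])
  have linear_X: "linear (X j)" for j
    unfolding assms(5) by (intro linear_compose_sum ballI linear_compose_scale_right assms(1))
  have x\<^sub>c_Y: "x\<^sub>c (Y k x) = map_matrix of_real (matrix (Y k)) *v x\<^sub>c x" for k x
  proof -
    have "x\<^sub>c (matrix (Y k) *v x) = map_matrix of_real (matrix (Y k)) *v x\<^sub>c x"
      by (simp add: x\<^sub>c_def vec_eq_iff matrix_vector_mult_def map_matrix_def)
    then show ?thesis by (simp only: Y_matrix)
  qed
  have z_Y: "z i (Y k x) = (\<Sum>p\<in>UNIV. b k $ i $ p * z p x)" for i k x
  proof -
    have "matrix_inv U *v x\<^sub>c (Y k x) = b k *v (matrix_inv U *v x\<^sub>c x)"
      by (simp only: x\<^sub>c_Y assms(7) matrix_vector_mul_assoc matrix_mul_assoc[symmetric] U matrix_mul_rid)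
    from arg_cong[OF this, of "\<lambda>v. v $ i"] show ?thesis by (simp add: z_def matrix_vector_mult_def)
  qed
  have z_linear: "linear (z i)" for i
    by (rule linearI) (auto simp: z_def x\<^sub>c_def matrix_vector_mult_def algebra_simps sum.distrib scaleR_sum_right
        scaleR_conv_of_real[where 'a = complex] sum_distrib_left)
  then have bl: "bounded_linear (z i)" for i by (simp add: linear_conv_bounded_linear)
  have linear_X_sum: "f (X j x) = (\<Sum>k\<in>UNIV. of_real (\<alpha> $ j $ k) * f (Y k x))"
    if "linear f" for f :: "real^'n::{finite,linorder} \<Rightarrow> complex" and j x
    by (simp add: assms(5) linear_sum[OF that] linear_scale[OF that]) (simp add: scaleR_conv_of_real)
  have z_X: "z i (X j x) = (\<Sum>p\<in>UNIV. c j i p * z p x)" for i j x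
    by (simp add: linear_X_sum[OF z_linear] z_Y c_def sum_distrib_left sum_distrib_right mult.assoc)
      (rule sum.swap)
  have c_tri: "c j i p = 0" if "p < i" for i j p
    using assms(8) that by (simp add: c_def upper_triangular_def)
  \<comment> \<open>Conjugation by \<open>U\<close> preserves the trace, so the divergences can be
    read off the diagonals.\<close>
  have tr_Y: "of_real (trace (matrix (Y k))) = trace (b k)" for k
  proof -
    have "trace (b k) = trace (map_matrix complex_of_real (matrix (Y k)))"
      by (simp only: assms(7) trace_mul_sym[of _ U] U_assoc)
    then show ?thesis by (simp add: trace_def map_matrix_def)
  qed
  have tr_X: "of_real (trace (matrix (X j))) = (\<Sum>i\<in>UNIV. c j i i)" for j
  proof -
    have "trace (matrix (X j)) = (\<Sum>k\<in>UNIV. \<alpha> $ j $ k * trace (matrix (Y k)))"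
      by (simp add: trace_def matrix_def assms(5) sum_distrib_left) (rule sum.swap)
    then have "complex_of_real (trace (matrix (X j))) = (\<Sum>k\<in>UNIV. of_real (\<alpha> $ j $ k) * trace (b k))"
      by (simp add: tr_Y[symmetric])
    also have "\<dots> = (\<Sum>i\<in>UNIV. c j i i)"
      by (simp add: trace_def c_def sum_distrib_left) (rule sum.swap)
    finally show ?thesis .
  qed
  have z_span: "z i \<in> cfun.span (range (\<lambda>i x. of_real (x $ i)))" for i
  proof -
    have "z i = (\<Sum>p\<in>UNIV. (\<lambda>x. matrix_inv U $ i $ p * of_real (x $ p)))"
      by (simp add: fun_eq_iff sum_fun_apply z_def x\<^sub>c_def matrix_vector_mult_def)
    then show ?thesis
      by (simp only:) (intro cfun.span_sum cfun.span_scale cfun.span_base rangeI)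
  qed
  have span_z: "(\<lambda>x. of_real (x $ i)) \<in> cfun.span (range z)" for i
  proof -
    have "U *v (matrix_inv U *v x\<^sub>c x) = x\<^sub>c x" for x
      by (simp add: matrix_vector_mul_assoc U)
    then have "(\<lambda>x. of_real (x $ i)) = (\<Sum>p\<in>UNIV. (\<lambda>x. U $ i $ p * z p x))"
      by (simp add: fun_eq_iff sum_fun_apply z_def vec_eq_iff) (simp add: x\<^sub>c_def matrix_vector_mult_def)
    then show ?thesis
      by (simp only:) (intro cfun.span_sum cfun.span_scale cfun.span_base rangeI)
  qed
  have E: "complexify_space (hom_polys r) = forms z r"
    unfolding complexify_hom_polys_eq_forms
    by (intro equalityI forms_mono z_span span_z)
  define d :: "nat^'n::{finite,linorder} \<Rightarrow> 'n \<Rightarrow> complex" where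
    "d = (\<lambda>J j. \<Sum>i\<in>UNIV. c j i i * (of_nat (J $ i) - 1))"
  have "\<exists>J\<in>multi_indices r. l = (\<chi> j. d J j)"
    if "f \<in> forms z r" "f \<noteq> 0" "\<And>j. twisted_lie (X j) f = (\<lambda>x. l $ j * f x)" for f l
    using twisted_lie_joint_eigenvalue[of X z c f r "($) l", OF linear_X bl z_X c_tri tr_X that]
    by (auto simp: d_def vec_eq_iff fun_eq_iff)
  moreover have "\<exists>f\<in>forms z r. f \<noteq> 0 \<and> (\<forall>j. twisted_lie (X j) f = (\<lambda>x. d J j * f x))"
    if J: "J \<in> multi_indices r" for J
  proof -
    have "\<exists>u. u \<noteq> 0 \<and> (\<forall>k. u v* b k = b k $ i $ i *s u)" for i
      using commuting_upper_triangular_left_eigenvector[of b i] assms(8) b_comm by metis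
    then obtain u where u: "\<And>i. u i \<noteq> 0" "\<And>i k. u i v* b k = b k $ i $ i *s u i" by metis
    \<comment> \<open>Rows are coefficient vectors of linear forms in \<open>z\<close>, and
      composing such a form with \<open>Y k\<close> multiplies its row by \<open>b k\<close> from
      the right. Left eigenvectors therefore give eigenforms.\<close>
    define g where "g = (\<lambda>i x. \<Sum>p\<in>UNIV. u i $ p * z p x)"
    have g_linear: "linear (g i)" for i
      unfolding g_def using z_linear
      by (intro linearI) (auto simp: linear_add linear_scale sum.distrib algebra_simps scaleR_sum_right)
    then have g_bl: "bounded_linear (g i)" for i by (simp add: linear_conv_bounded_linear)
    have g_Y: "g i (Y k x) = b k $ i $ i * g i x" for i k x
    proof -
      have "g i (Y k x) = (\<Sum>q\<in>UNIV. \<Sum>p\<in>UNIV. u i $ p * (b k $ p $ q * z q x))"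
        by (simp add: g_def z_Y sum_distrib_left) (rule sum.swap)
      also have "\<dots> = (\<Sum>q\<in>UNIV. (u i v* b k) $ q * z q x)"
        by (simp add: vector_matrix_mult_def sum_distrib_right mult.assoc)
      finally show ?thesis by (simp add: u g_def sum_distrib_left mult.assoc)
    qed
    have g_X: "g i (X j x) = c j i i * g i x" for i j x
      by (simp add: linear_X_sum[OF g_linear] g_Y c_def sum_distrib_right mult.assoc)
    have "g i = (\<Sum>p\<in>UNIV. (\<lambda>x. u i $ p * z p x))" for i
      by (simp add: g_def fun_eq_iff sum_fun_apply)
    then have "g i \<in> cfun.span (range z)" for i
      by (simp only:) (intro cfun.span_sum cfun.span_scale cfun.span_base rangeI)
    then have "monomial_in g J \<in> forms z r"
      using J by (rule monomial_in_linear_forms)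
    moreover have "monomial_in g J \<noteq> 0"
    proof -
      \<comment> \<open>In the coordinates of R^n the form \<open>g i\<close> has the nonzero
        coefficient row \<open>u i v* matrix_inv U\<close>. The forms are functions on R^n only, so
        a real point is needed at which no \<open>g i\<close> vanishes.\<close>
      have "u i v* matrix_inv U \<noteq> 0" for i
      proof
        assume "u i v* matrix_inv U = 0"
        then have "(u i v* matrix_inv U) v* U = 0" by simp
        then show False using u(1) by (simp add: vector_matrix_mul_assoc U)
      qed
      then have "0 \<notin> range (\<lambda>i. u i v* matrix_inv U)" by fastforce
      then obtain x where x: "\<And>m. m \<in> range (\<lambda>i. u i v* matrix_inv U) \<Longrightarrow>
          (\<Sum>q\<in>UNIV. m $ q * of_real (x $ q)) \<noteq> 0"
        by (rule real_vector_off_hyperplanes[rotated]) auto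
      have "g i x = (\<Sum>q\<in>UNIV. (u i v* matrix_inv U) $ q * of_real (x $ q))" for i
      proof -
        have "g i x = (\<Sum>q\<in>UNIV. \<Sum>p\<in>UNIV. u i $ p * (matrix_inv U $ p $ q * of_real (x $ q)))"
          by (simp add: g_def z_def x\<^sub>c_def matrix_vector_mult_def sum_distrib_left) (rule sum.swap)
        then show ?thesis by (simp add: vector_matrix_mult_def sum_distrib_right mult.assoc)
      qed
      then have "g i x \<noteq> 0" for i using x by simp
      then have "monomial_in g J x \<noteq> 0" by (simp add: monomial_in_def)
      then show ?thesis by (metis zero_fun_apply)
    qed
    moreover have "twisted_lie (X j) (monomial_in g J) = (\<lambda>x. d J j * monomial_in g J x)" for j
      unfolding d_def by (intro twisted_lie_monomial_in_eigenforms linear_X g_bl g_X tr_X)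
    ultimately show ?thesis by blast
  qed
  ultimately have "joint_spectrum (forms z r) (\<lambda>j. twisted_lie (X j)) = (\<lambda>J. \<chi> j. d J j) ` multi_indices r"
    unfolding joint_spectrum_def zero_fun_def by (auto simp: image_iff)
  also have "\<dots> = {map_matrix complex_of_real \<alpha> *v (B *v (\<chi> i. of_int (I $ i))) | I :: int^'n::{finite,linorder}.
            (\<forall>i. I $ i \<in> \<nat> \<union> {-1}) \<and> (\<Sum>i\<in>UNIV. I $ i) = int r - int CARD('n::{finite,linorder})}"
  proof -
    have "(\<chi> j. d J j) = map_matrix complex_of_real \<alpha> *v (B *v (\<chi> i. of_int ((\<chi> i. int (J $ i) - 1) $ i)))" for J
    proof -
      \<comment> \<open>Exchanging the sums over fields and diagonal positions exhibits the product
        of \<alpha>, \<open>B\<close> and the shifted index.\<close>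
      have "d J j = (\<Sum>k\<in>UNIV. \<Sum>i\<in>UNIV. of_real (\<alpha> $ j $ k) * (b k $ i $ i * (of_nat (J $ i) - 1)))" for j
        by (simp add: d_def c_def sum_distrib_right mult.assoc) (rule sum.swap)
      then show ?thesis
        by (simp add: vec_eq_iff matrix_vector_mult_def map_matrix_def assms(9) sum_distrib_left)
    qed
    then show ?thesis unfolding shifted_multi_indices by simp
  qed
  finally show ?thesis unfolding E[symmetric] twisted_lie_def .
qed

end
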